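(* Consider the two optimization problems, with all data and the functions $\tilde f_i$ and sets $\mathbb{U}_i$, $\mathbb{Z}_i$ as defined in the context. Problem (P): minimize over $u=(u_1,\dots,u_M)$ and $v=(v_0,\dots,v_{N-1})$ $$\sum_{i=1}^{M}\Big(f_i(u_i)+\sum_{k=0}^{N-1}\pi_k F_i u_{i,k}\Big)$$ subject to $v_k=\sum_{i=1}^{M}G_iF_iu_{i,k}+\tilde v_k$ and $\underline v\le v_k\le\overline v$ for all $k\in\{0,\dots,N-1\}$, and $u_i\in\mathbb{U}_i$ for all $i\in\{1,\dots,M\}$. Problem (D): minimize over $z=(z_1,\dots,z_M)$ with $z_i=(u_i,s_i)$ $$\sum_{i=1}^{M}\tilde f_i(u_i)$$ subject to $\sum_{i=1}^{M}s_i=0$ and $z_i\in\mathbb{Z}_i$ for all $i\in\{1,\dots,M\}$. Then: 1. If Problem (P) is feasible and $u^*$ is (the $u$-component of) its solution, then Problem (D) has a solution $\hat z=(\hat u,\hat s)$ with $\hat u=u^*$. 2. Conversely, if Problem (D) is feasible and $\hat z=(\hat u,\hat s)$ is a solution of it, then $\hat u$ is the minimizer (in the $u$-component) of Problem (P).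
   Context: Let $M,N\ge 1$ be integers ($M$ buildings, prediction horizon $N$). For each $i\in\{1,\dots,M\}$: - $u_i=(u_{i,0},\dots,u_{i,N-1})$ with $u_{i,k}\in\mathbb{R}^{n_{u_i}}$, so $u_i\in\mathbb{R}^{Nn_{u_i}}$. - Given are real matrices $A_i,B_i,C_i,D_i$ of compatible dimensions, an initial state $\hat x_i\in\mathbb{R}^{n_{x_i}}$, and disturbances $w_{i,k}\in\mathbb{R}^{n_{x_i}}$. For each $u_i$, define states $x_{i,k}\in\mathbb{R}^{n_{x_i}}$ and outputs $y_{i,k}\in\mathbb{R}^{n_{y_i}}$ by $x_{i,0}=\hat x_i$, $x_{i,k+1}=A_ix_{i,k}+B_iu_{i,k}+w_{i,k}$, $y_{i,k}=C_ix_{i,k}+D_iu_{i,k}$ for $k=0,\dots,N-1$. Thus $y_{i,k}$ is an affine function of $u_i$. - Given are a reference $y_i^{\mathrm{ref}}\in\mathbb{R}^{n_{y_i}}$, a symmetric positive semidefinite matrix $Q_i\in\mathbb{R}^{n_{y_i}\times n_{y_i}}$ and a symmetric positive definite matrix $R_i\in\mathbb{R}^{n_{u_i}\times n_{u_i}}$. Write $\|x\|_\Sigma=\sqrt{x^\top\Sigma x}$. The tracking cost $\sum_{k=0}^{N-1}\big(\|y_{i,k}-y_i^{\mathrm{ref}}\|_{Q_i}^2+\|u_{i,k}\|_{R_i}^2\big)$, as a function of $u_i$, is quadratic; $f_i(u_i)$ denotes this function minus its (constant) value at $u_i=0$. Hence $f_i(u_i)=u_i^\top H_iu_i+2h_i^\top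 u_i$ for a vector $h_i$ and a symmetric positive definite matrix $H_i$. - Given are real vectors of bounds $\underline y_i,\overline y_i\in\mathbb{R}^{n_{y_i}}$ and $\underline u_i,\overline u_i\in\mathbb{R}^{n_{u_i}}$. The set $\mathbb{U}_i\subseteq\mathbb{R}^{Nn_{u_i}}$ consists of all $u_i$ such that, componentwise, $\underline y_i\le y_{i,k}\le\overline y_i$ and $\underline u_i\le u_{i,k}\le\overline u_i$ for all $k=0,\dots,N-1$. It is a compact convex polyhedron. - Given are $F_i\in\mathbb{R}^{1\times n_{u_i}}$ and $G_i\in\mathbb{R}$. Further data: real numbers $\pi_k$ and $\tilde v_k$ for $k=0,\dots,N-1$, and real bounds $\underline v,\overline v$. The variables $v_k$ are real. The objective terms of Problem (D) are $$\tilde f_i(u_i)=f_i(u_i)+\sum_{k=0}^{N-1}\pi_kF_iu_{i,k}.$$ Auxiliary variables: $s_i=(s_{i,0},\dots,s_{i,N-1})$ with $s_{i,k}\in\mathbb{R}^2$, so $s_i\in\mathbb{R}^{2N}$. The constraint sets are $$\mathbb{Z}_i=\left\{(u_i,s_i)\in\mathbb{R}^{Nn_{u_i}+2N}\ :\ u_i\in\mathbb{U}_i,\ \begin{pmatrix}\frac{\tilde v_k-\overline v}{M}+G_iF_iu_{i,k}\\[2pt] \frac{\underline v-\tilde v_k}{M}-G_iF_iu_{i,k}\end{pmatrix}-s_{i,k}\le 0\ \text{ for all }k\in\{0,\dots,N-1\}\right\},$$ with the inequality understood componentwise. A solution (minimizer) of a problem means a feasible point attaining the minimal objective value among feasible points.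 In Problem (P), $v$ is determined by $u$ through the equality constraints, so feasible points and solutions are identified with their $u$-component. *)

theory Defs
  imports Complex_Main "HOL-Library.FuncSet" "Jordan_Normal_Form.Matrix"
begin

text \<open>
  The dimensions depend on the building, so the matrices and vectors are those with explicit
  carriers. A stacked vector (such as all inputs of one building over the horizon) is
  represented by the family of its blocks, that is, by an element of an extensional function
  space \<open>PiE\<close>; in this way equality of functions is equality of stacked vectors.
  Buildings are numbered by \<open>{1..M}\<close>, time steps by \<open>{..<N}\<close>.
\<close>

definition psd_mat :: "nat \<Rightarrow> real mat \<Rightarrow> bool" where
  "psd_mat n S \<longleftrightarrow> S \<in> carrier_mat n n \<and> transpose_mat S = S \<and>
     (\<forall>x \<in> carrier_vec n. 0 \<le> x \<bullet> (S *\<^sub>v x))"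

definition pd_mat :: "nat \<Rightarrow> real mat \<Rightarrow> bool" where
  "pd_mat n S \<longleftrightarrow> S \<in> carrier_mat n n \<and> transpose_mat S = S \<and>
     (\<forall>x \<in> carrier_vec n. x \<noteq> 0\<^sub>v n \<longrightarrow> 0 < x \<bullet> (S *\<^sub>v x))"

definition wnorm :: "real mat \<Rightarrow> real vec \<Rightarrow> real" where
  "wnorm S x = sqrt (x \<bullet> (S *\<^sub>v x))"

record building =
  dim_x :: nat
  dim_u :: nat
  dim_y :: nat
  mat_A :: "real mat"
  mat_B :: "real mat"
  mat_C :: "real mat"
  mat_D :: "real mat"
  init_x :: "real vec"
  dist_w :: "nat \<Rightarrow> real vec"
  ref_y :: "real vec"
  mat_Q :: "real mat"
  mat_R :: "real mat"
  lower_y :: "real vec"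
  upper_y :: "real vec"
  lower_u :: "real vec"
  upper_u :: "real vec"
  mat_F :: "real mat"
  gain_G :: real

definition building_ok :: "nat \<Rightarrow> building \<Rightarrow> bool" where
  "building_ok N b \<longleftrightarrow>
     mat_A b \<in> carrier_mat (dim_x b) (dim_x b) \<and>
     mat_B b \<in> carrier_mat (dim_x b) (dim_u b) \<and>
     mat_C b \<in> carrier_mat (dim_y b) (dim_x b) \<and>
     mat_D b \<in> carrier_mat (dim_y b) (dim_u b) \<and>
     init_x b \<in> carrier_vec (dim_x b) \<and>
     (\<forall>k<N. dist_w b k \<in> carrier_vec (dim_x b)) \<and>
     ref_y b \<in> carrier_vec (dim_y b) \<and>
     psd_mat (dim_y b) (mat_Q b) \<and>
     pd_mat (dim_u b) (mat_R b) \<and>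
     lower_y b \<in> carrier_vec (dim_y b) \<and> upper_y b \<in> carrier_vec (dim_y b) \<and>
     lower_u b \<in> carrier_vec (dim_u b) \<and> upper_u b \<in> carrier_vec (dim_u b) \<and>
     mat_F b \<in> carrier_mat 1 (dim_u b)"

type_synonym blocks = "nat \<Rightarrow> real vec"

definition block_space :: "nat \<Rightarrow> nat \<Rightarrow> blocks set" where
  "block_space N d = (\<Pi>\<^sub>E k\<in>{..<N}. carrier_vec d)"

primrec state :: "building \<Rightarrow> blocks \<Rightarrow> nat \<Rightarrow> real vec" where
  "state b u 0 = init_x b"
| "state b u (Suc k) = mat_A b *\<^sub>v state b u k + mat_B b *\<^sub>v u k + dist_w b k"

definition y_out :: "building \<Rightarrow> blocks \<Rightarrow> nat \<Rightarrow> real vec" where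
  "y_out b u k = mat_C b *\<^sub>v state b u k + mat_D b *\<^sub>v u k"

definition tracking_cost :: "nat \<Rightarrow> building \<Rightarrow> blocks \<Rightarrow> real" where
  "tracking_cost N b u =
     (\<Sum>k<N. (wnorm (mat_Q b) (y_out b u k - ref_y b))\<^sup>2 + (wnorm (mat_R b) (u k))\<^sup>2)"

definition cost_f :: "nat \<Rightarrow> building \<Rightarrow> blocks \<Rightarrow> real" where
  "cost_f N b u = tracking_cost N b u - tracking_cost N b (\<lambda>k\<in>{..<N}. 0\<^sub>v (dim_u b))"

definition set_U :: "nat \<Rightarrow> building \<Rightarrow> blocks set" where
  "set_U N b = {u \<in> block_space N (dim_u b). \<forall>k<N.
     lower_y b \<le> y_out b u k \<and> y_out b u k \<le> upper_y b \<and>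
     lower_u b \<le> u k \<and> u k \<le> upper_u b}"

(* the 1-by-1 product F u_k, read as a real number *)
definition F_app :: "building \<Rightarrow> blocks \<Rightarrow> nat \<Rightarrow> real" where
  "F_app b u k = (mat_F b *\<^sub>v u k) $ 0"

record problem =
  num_buildings :: nat
  horizon :: nat
  bldg :: "nat \<Rightarrow> building"
  price :: "nat \<Rightarrow> real"
  v_tilde :: "nat \<Rightarrow> real"
  v_lower :: real
  v_upper :: real

definition problem_ok :: "problem \<Rightarrow> bool" where
  "problem_ok p \<longleftrightarrow> num_buildings p \<ge> 1 \<and> horizon p \<ge> 1 \<and>
     (\<forall>i\<in>{1..num_buildings p}. building_ok (horizon p) (bldg p i))"

definition feasible_P :: "problem \<Rightarrow> (nat \<Rightarrow> blocks) \<times> (nat \<Rightarrow> real) \<Rightarrow> bool" where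
  "feasible_P p = (\<lambda>(u, v).
     u \<in> (\<Pi>\<^sub>E i\<in>{1..num_buildings p}. set_U (horizon p) (bldg p i)) \<and>
     v \<in> (\<Pi>\<^sub>E k\<in>{..<horizon p}. UNIV) \<and>
     (\<forall>k<horizon p.
        v k = (\<Sum>i = 1..num_buildings p. gain_G (bldg p i) * F_app (bldg p i) (u i) k)
              + v_tilde p k \<and>
        v_lower p \<le> v k \<and> v k \<le> v_upper p))"

definition objective_P :: "problem \<Rightarrow> (nat \<Rightarrow> blocks) \<times> (nat \<Rightarrow> real) \<Rightarrow> real" where
  "objective_P p = (\<lambda>(u, v). \<Sum>i = 1..num_buildings p.
     cost_f (horizon p) (bldg p i) (u i)
     + (\<Sum>k<horizon p. price p k * F_app (bldg p i) (u i) k))"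

definition solution_P :: "problem \<Rightarrow> (nat \<Rightarrow> blocks) \<times> (nat \<Rightarrow> real) \<Rightarrow> bool" where
  "solution_P p = is_arg_min (objective_P p) (feasible_P p)"

definition f_tilde :: "problem \<Rightarrow> nat \<Rightarrow> blocks \<Rightarrow> real" where
  "f_tilde p i u = cost_f (horizon p) (bldg p i) u
     + (\<Sum>k<horizon p. price p k * F_app (bldg p i) u k)"

definition set_Z :: "problem \<Rightarrow> nat \<Rightarrow> (blocks \<times> blocks) set" where
  "set_Z p i = {(u, s). u \<in> set_U (horizon p) (bldg p i) \<and> s \<in> block_space (horizon p) 2 \<and>
     (\<forall>k<horizon p.
        vec_of_list
          [(v_tilde p k - v_upper p) / real (num_buildings p)
             + gain_G (bldg p i) * F_app (bldg p i) u k,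
           (v_lower p - v_tilde p k) / real (num_buildings p)
             - gain_G (bldg p i) * F_app (bldg p i) u k]
        - s k \<le> 0\<^sub>v 2)}"

definition feasible_D :: "problem \<Rightarrow> (nat \<Rightarrow> blocks \<times> blocks) \<Rightarrow> bool" where
  "feasible_D p z \<longleftrightarrow>
     z \<in> (\<Pi>\<^sub>E i\<in>{1..num_buildings p}. set_Z p i) \<and>
     (\<forall>k<horizon p.
        finsum_vec TYPE(real) 2 (\<lambda>i. snd (z i) k) {1..num_buildings p} = 0\<^sub>v 2)"

definition objective_D :: "problem \<Rightarrow> (nat \<Rightarrow> blocks \<times> blocks) \<Rightarrow> real" where
  "objective_D p z = (\<Sum>i = 1..num_buildings p. f_tilde p i (fst (z i)))"

definition solution_D :: "problem \<Rightarrow> (nat \<Rightarrow> blocks \<times> blocks) \<Rightarrow> bool" where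
  "solution_D p = is_arg_min (objective_D p) (feasible_D p)"

definition u_part :: "problem \<Rightarrow> (nat \<Rightarrow> blocks \<times> blocks) \<Rightarrow> nat \<Rightarrow> blocks" where
  "u_part p z = (\<lambda>i\<in>{1..num_buildings p}. fst (z i))"

end

theory Submission
  imports Defs
begin

text \<open>
  The slack \<open>s\<^sub>i\<close> redistributes the coupling constraint: if the local terms \<open>a\<^sub>i\<close> sum to a
  nonpositive number, then \<open>s\<^sub>i = a\<^sub>i - (\<Sum>\<^sub>j a\<^sub>j) / M\<close> dominates every \<open>a\<^sub>i\<close> and sums to zero;
  conversely, summing \<open>a\<^sub>i \<le> s\<^sub>i\<close> recovers the coupling constraint. So the two problems have the
  same feasible inputs and the same objective. Minimizers are unique because the tracking
  cost is strictly midpoint convex: the outputs are affine in the inputs, \<open>Q\<close> is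
  positive semidefinite and \<open>R\<close> is positive definite.
\<close>

section \<open>Midpoints of vectors\<close>

text \<open>Of all convex combinations only the midpoint occurs: it is enough for uniqueness, since
  the midpoint of two distinct minimizers would be strictly better than both.\<close>

definition vmid :: "real vec \<Rightarrow> real vec \<Rightarrow> real vec" where
  "vmid x y = (1/2) \<cdot>\<^sub>v (x + y)"

lemma vmid_carrier [simp]: "x \<in> carrier_vec n \<Longrightarrow> y \<in> carrier_vec n \<Longrightarrow> vmid x y \<in> carrier_vec n"
  by (simp add: vmid_def)

lemma dim_vmid [simp]: "dim_vec (vmid x y) = dim_vec y"
  by (simp add: vmid_def)

lemma index_vmid [simp]:
  "x \<in> carrier_vec n \<Longrightarrow> y \<in> carrier_vec n \<Longrightarrow> i < n \<Longrightarrow> vmid x y $ i = (x $ i + y $ i) / 2"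
  by (simp add: vmid_def)

lemma vmid_add:
  assumes "a \<in> carrier_vec n" "b \<in> carrier_vec n" "c \<in> carrier_vec n" "d \<in> carrier_vec n"
  shows "vmid (a + b) (c + d) = vmid a c + vmid b d"
  using assms by (intro eq_vecI) (auto simp: vmid_def algebra_simps)

lemma vmid_minus:
  assumes "a \<in> carrier_vec n" "b \<in> carrier_vec n" "c \<in> carrier_vec n" "d \<in> carrier_vec n"
  shows "vmid (a - b) (c - d) = vmid a c - vmid b d"
  using assms by (intro eq_vecI) (auto simp: vmid_def algebra_simps diff_divide_distrib)

text \<open>Lets constant data (initial state, disturbance, reference) be written as midpoints, so
  that affine maps are treated by the same rules as linear ones.\<close>

lemma vmid_self: "vmid x x = x"
  by (intro eq_vecI) (auto simp: vmid_def)

lemma mult_mat_vmid: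
  assumes "A \<in> carrier_mat m n" "x \<in> carrier_vec n" "y \<in> carrier_vec n"
  shows "A *\<^sub>v vmid x y = vmid (A *\<^sub>v x) (A *\<^sub>v y)"
  using assms
  by (simp add: vmid_def mult_mat_vec[of A m n] mult_add_distrib_mat_vec[of A m n])

text \<open>The order on vectors includes equality of dimensions, so both hypotheses together force
  \<open>x\<close> and \<open>y\<close> to have the same length. With \<open>vmid_ge\<close> this
  gives the convexity of box constraints.\<close>

lemma vmid_le:
  assumes "l \<le> x" "l \<le> y" shows "l \<le> vmid x y"
  unfolding less_eq_vec_def
proof (intro conjI allI impI)
  show "dim_vec l = dim_vec (vmid x y)"
    using assms by (simp add: less_eq_vec_def)
  fix i assume i: "i < dim_vec (vmid x y)"
  then have "l $ i \<le> x $ i" "l $ i \<le> y $ i" "dim_vec x = dim_vec y"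
    using assms by (auto simp: less_eq_vec_def)
  then show "l $ i \<le> vmid x y $ i"
    using i by (simp add: vmid_def)
qed

lemma vmid_ge:
  assumes "x \<le> l" "y \<le> l" shows "vmid x y \<le> l"
  unfolding less_eq_vec_def
proof (intro conjI allI impI)
  show "dim_vec (vmid x y) = dim_vec l"
    using assms by (simp add: less_eq_vec_def)
  fix i assume i: "i < dim_vec l"
  then have "x $ i \<le> l $ i" "y $ i \<le> l $ i" "dim_vec x = dim_vec y" "i < dim_vec y"
    using assms by (auto simp: less_eq_vec_def)
  then show "vmid x y $ i \<le> l $ i"
    by (simp add: vmid_def)
qed

section \<open>Quadratic forms and weighted norms at midpoints\<close>

text \<open>Parallelogram law: the cross terms enter the midpoint and the difference with opposite
  signs and cancel. The last summand is the convexity gap, nonnegative for semidefinite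
  \<open>S\<close> and positive for definite \<open>S\<close> and
  \<open>x \<noteq> y\<close>.\<close>

lemma quadratic_form_vmid:
  assumes S: "S \<in> carrier_mat n n" and x: "x \<in> carrier_vec n" and y: "y \<in> carrier_vec n"
  shows "x \<bullet> (S *\<^sub>v x) + y \<bullet> (S *\<^sub>v y)
       = 2 * (vmid x y \<bullet> (S *\<^sub>v vmid x y)) + ((x - y) \<bullet> (S *\<^sub>v (x - y))) / 2"
proof -
  have c: "S *\<^sub>v x \<in> carrier_vec n" "S *\<^sub>v y \<in> carrier_vec n"
    using S x y by auto
  have m: "vmid x y \<bullet> (S *\<^sub>v vmid x y) = (x \<bullet> (S *\<^sub>v x) + x \<bullet> (S *\<^sub>v y) + y \<bullet> (S *\<^sub>v x) + y \<bullet> (S *\<^sub>v y)) / 4"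
    unfolding mult_mat_vmid[OF S x y] using x y c
    by (simp add: vmid_def scalar_prod_add_distrib[of _ n] add_scalar_prod_distrib[of _ n]
        smult_scalar_prod_distrib[of _ n] scalar_prod_smult_distrib[of _ n] field_simps)
  have d: "(x - y) \<bullet> (S *\<^sub>v (x - y)) = x \<bullet> (S *\<^sub>v x) - x \<bullet> (S *\<^sub>v y) - y \<bullet> (S *\<^sub>v x) + y \<bullet> (S *\<^sub>v y)"
    unfolding mult_minus_distrib_mat_vec[OF S x y] using x y c
    by (simp add: scalar_prod_minus_distrib[of _ n] minus_scalar_prod_distrib[of _ n])
  show ?thesis unfolding m d by (simp add: field_simps)
qed

lemma pd_imp_psd:
  assumes "pd_mat n S" shows "psd_mat n S"
proof -
  have "0 \<le> x \<bullet> (S *\<^sub>v x)" if "x \<in> carrier_vec n" for x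
  proof (cases "x = 0\<^sub>v n")
    case True
    have "S *\<^sub>v x \<in> carrier_vec n"
      using assms that by (auto simp: pd_mat_def)
    then show ?thesis using True by simp
  next
    case False
    then show ?thesis using assms that by (auto simp: pd_mat_def intro: less_imp_le)
  qed
  then show ?thesis using assms by (simp add: pd_mat_def psd_mat_def)
qed

text \<open>Semidefiniteness makes the radicand nonnegative, so squaring undoes the root.\<close>

lemma wnorm_sq: "psd_mat n S \<Longrightarrow> x \<in> carrier_vec n \<Longrightarrow> (wnorm S x)\<^sup>2 = x \<bullet> (S *\<^sub>v x)"
  by (simp add: wnorm_def psd_mat_def)

lemma wnorm_vmid_le:
  assumes S: "psd_mat n S" and x: "x \<in> carrier_vec n" and y: "y \<in> carrier_vec n"
  shows "2 * (wnorm S (vmid x y))\<^sup>2 \<le> (wnorm S x)\<^sup>2 + (wnorm S y)\<^sup>2"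
proof -
  have "S \<in> carrier_mat n n" "0 \<le> (x - y) \<bullet> (S *\<^sub>v (x - y))"
    using S x y by (auto simp: psd_mat_def)
  then show ?thesis
    using quadratic_form_vmid[OF _ x y, of S] by (simp add: wnorm_sq[OF S] x y)
qed

lemma wnorm_vmid_less:
  assumes S: "pd_mat n S" and x: "x \<in> carrier_vec n" and y: "y \<in> carrier_vec n" and "x \<noteq> y"
  shows "2 * (wnorm S (vmid x y))\<^sup>2 < (wnorm S x)\<^sup>2 + (wnorm S y)\<^sup>2"
proof -
  \<comment> \<open>Definiteness speaks about nonzero vectors, so distinctness is first turned into
    a nonzero difference.\<close>
  have "x - y \<noteq> 0\<^sub>v n"
  proof
    assume "x - y = 0\<^sub>v n"
    then have "x $ i - y $ i = 0" if "i < n" for i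
      using that x y by (metis carrier_vecD index_minus_vec(1) index_zero_vec(1))
    then have "x = y" using x y by (intro eq_vecI) auto
    with \<open>x \<noteq> y\<close> show False ..
  qed
  then have "S \<in> carrier_mat n n" "0 < (x - y) \<bullet> (S *\<^sub>v (x - y))"
    using S x y by (auto simp: pd_mat_def)
  then show ?thesis
    using quadratic_form_vmid[OF _ x y, of S] by (simp add: wnorm_sq[OF pd_imp_psd[OF S]] x y)
qed

section \<open>Dynamics, costs and constraints of one building at the midpoint of two inputs\<close>

text \<open>The summand of \<open>tracking_cost\<close>, named so that convexity can be shown one
  time step at a time.\<close>

definition stage_cost :: "building \<Rightarrow> blocks \<Rightarrow> nat \<Rightarrow> real" where
  "stage_cost b u k = (wnorm (mat_Q b) (y_out b u k - ref_y b))\<^sup>2 + (wnorm (mat_R b) (u k))\<^sup>2"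

lemma tracking_cost_eq: "tracking_cost N b u = (\<Sum>k<N. stage_cost b u k)"
  by (simp add: tracking_cost_def stage_cost_def)

text \<open>The restriction makes the midpoint extensional, as membership in
  \<open>block_space\<close> demands.\<close>

definition bmid :: "nat \<Rightarrow> blocks \<Rightarrow> blocks \<Rightarrow> blocks" where
  "bmid N u u' = (\<lambda>k\<in>{..<N}. vmid (u k) (u' k))"

lemma bmid_apply [simp]: "k < N \<Longrightarrow> bmid N u u' k = vmid (u k) (u' k)"
  by (simp add: bmid_def)

lemma block_space_carrier: "u \<in> block_space N d \<Longrightarrow> k < N \<Longrightarrow> u k \<in> carrier_vec d"
  by (auto simp: block_space_def)

context
  fixes N b
  assumes ok: "building_ok N b"
begin

text \<open>The bound is \<open>k \<le> N\<close> rather than \<open>k < N\<close>, because the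
  state at \<open>N\<close> still depends only on inputs and disturbances with index below
  \<open>N\<close>.\<close>

lemma state_carrier:
  assumes "u \<in> block_space N (dim_u b)" "k \<le> N"
  shows "state b u k \<in> carrier_vec (dim_x b)"
  using assms(2)
proof (induction k)
  case 0
  then show ?case using ok by (simp add: building_ok_def)
next
  case (Suc k)
  then show ?case using ok block_space_carrier[OF assms(1), of k]
    by (auto simp: building_ok_def intro!: add_carrier_vec mult_mat_vec_carrier)
qed

lemma y_out_carrier:
  assumes "u \<in> block_space N (dim_u b)" "k < N"
  shows "y_out b u k \<in> carrier_vec (dim_y b)"
  using ok block_space_carrier[OF assms] state_carrier[OF assms(1), of k] assms(2)
  by (auto simp: building_ok_def y_out_def intro!: add_carrier_vec mult_mat_vec_carrier)

context
  fixes u u'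
  assumes u: "u \<in> block_space N (dim_u b)" and u': "u' \<in> block_space N (dim_u b)"
begin

text \<open>The state recursion is affine in the input, and affine maps preserve midpoints.\<close>

lemma state_bmid:
  assumes "k \<le> N"
  shows "state b (bmid N u u') k = vmid (state b u k) (state b u' k)"
  using assms
proof (induction k)
  case 0
  then show ?case by (simp add: vmid_self)
next
  case (Suc k)
  note c = block_space_carrier[OF u, of k] block_space_carrier[OF u', of k]
    state_carrier[OF u, of k] state_carrier[OF u', of k]
  have A: "mat_A b \<in> carrier_mat (dim_x b) (dim_x b)"
   and B: "mat_B b \<in> carrier_mat (dim_x b) (dim_u b)"
   and w: "dist_w b k \<in> carrier_vec (dim_x b)"
    using ok Suc.prems by (auto simp: building_ok_def)
  \<comment> \<open>The disturbance is written as the midpoint of itself with itself, so that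
    \<open>vmid_add\<close> can collect all three terms.\<close>
  have "state b (bmid N u u') (Suc k) =
    vmid (mat_A b *\<^sub>v state b u k) (mat_A b *\<^sub>v state b u' k)
    + vmid (mat_B b *\<^sub>v u k) (mat_B b *\<^sub>v u' k) + vmid (dist_w b k) (dist_w b k)"
    using Suc c by (simp add: vmid_self mult_mat_vmid[OF A] mult_mat_vmid[OF B])
  also have "\<dots> = vmid (state b u (Suc k)) (state b u' (Suc k))"
    using c A B w Suc.prems by (simp add: vmid_add[of _ "dim_x b"])
  finally show ?case .
qed

lemma y_out_bmid:
  assumes k: "k < N"
  shows "y_out b (bmid N u u') k = vmid (y_out b u k) (y_out b u' k)"
proof -
  note c = block_space_carrier[OF u k] block_space_carrier[OF u' k]
    state_carrier[OF u, of k] state_carrier[OF u', of k]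
  have C: "mat_C b \<in> carrier_mat (dim_y b) (dim_x b)"
   and D: "mat_D b \<in> carrier_mat (dim_y b) (dim_u b)"
    using ok by (auto simp: building_ok_def)
  show ?thesis
    using c C D k
    by (simp add: y_out_def state_bmid mult_mat_vmid[OF C] mult_mat_vmid[OF D]
        vmid_add[of _ "dim_y b"])
qed

lemma F_app_bmid:
  assumes k: "k < N"
  shows "F_app b (bmid N u u') k = (F_app b u k + F_app b u' k) / 2"
proof -
  have F: "mat_F b \<in> carrier_mat 1 (dim_u b)"
    using ok by (auto simp: building_ok_def)
  note c = block_space_carrier[OF u k] block_space_carrier[OF u' k]
  have "mat_F b *\<^sub>v u k \<in> carrier_vec 1" "mat_F b *\<^sub>v u' k \<in> carrier_vec 1"
    using F c by auto
  then show ?thesis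
    using k by (simp add: F_app_def mult_mat_vmid[OF F c])
qed

text \<open>The output term contributes only a weak inequality, \<open>mat_Q b\<close> being
  semidefinite. Strictness comes from the input term, through the definiteness of
  \<open>mat_R b\<close>.\<close>

lemma stage_cost_bmid:
  assumes k: "k < N"
  shows stage_cost_bmid_le:
      "2 * stage_cost b (bmid N u u') k \<le> stage_cost b u k + stage_cost b u' k" (is "?l \<le> ?r")
    and stage_cost_bmid_less:
      "u k \<noteq> u' k \<Longrightarrow> 2 * stage_cost b (bmid N u u') k < stage_cost b u k + stage_cost b u' k"
proof -
  have Q: "psd_mat (dim_y b) (mat_Q b)" and R: "pd_mat (dim_u b) (mat_R b)"
    and r: "ref_y b \<in> carrier_vec (dim_y b)"
    using ok by (auto simp: building_ok_def)
  note c = block_space_carrier[OF u k] block_space_carrier[OF u' k]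
  note y = y_out_carrier[OF u k] y_out_carrier[OF u' k]
  have mid: "y_out b (bmid N u u') k - ref_y b = vmid (y_out b u k - ref_y b) (y_out b u' k - ref_y b)"
    using y r by (simp add: y_out_bmid[OF k] vmid_minus[of _ "dim_y b"] vmid_self)
  have "2 * (wnorm (mat_Q b) (y_out b (bmid N u u') k - ref_y b))\<^sup>2
    \<le> (wnorm (mat_Q b) (y_out b u k - ref_y b))\<^sup>2 + (wnorm (mat_Q b) (y_out b u' k - ref_y b))\<^sup>2"
    unfolding mid by (rule wnorm_vmid_le[OF Q]) (use y r in auto)
  then show "?l \<le> ?r" and "u k \<noteq> u' k \<Longrightarrow> ?l < ?r"
    using wnorm_vmid_le[OF pd_imp_psd[OF R] c] wnorm_vmid_less[OF R c] k by (auto simp: stage_cost_def)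
qed

lemma tracking_cost_bmid_le:
  "2 * tracking_cost N b (bmid N u u') \<le> tracking_cost N b u + tracking_cost N b u'"
proof -
  have "(\<Sum>k<N. 2 * stage_cost b (bmid N u u') k) \<le> (\<Sum>k<N. stage_cost b u k + stage_cost b u' k)"
    by (rule sum_mono) (rule stage_cost_bmid_le, simp)
  then show ?thesis
    by (simp only: tracking_cost_eq sum_distrib_left sum.distrib)
qed

lemma tracking_cost_bmid_less:
  assumes "u \<noteq> u'"
  shows "2 * tracking_cost N b (bmid N u u') < tracking_cost N b u + tracking_cost N b u'"
proof -
  \<comment> \<open>Both families are extensional, so they must differ at some step below
    \<open>N\<close>; one strict stage then makes the whole sum strict.\<close>
  obtain k where k: "k < N" "u k \<noteq> u' k"
  proof (rule ccontr)
    assume "\<not> thesis"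
    then have "u k = u' k" if "k \<in> {..<N}" for k
      using that \<open>\<And>k. k < N \<Longrightarrow> u k \<noteq> u' k \<Longrightarrow> thesis\<close> by blast
    then have "u = u'"
      using u u' unfolding block_space_def by (rule PiE_ext[rotated 2])
    with assms show False ..
  qed
  have "(\<Sum>k<N. 2 * stage_cost b (bmid N u u') k) < (\<Sum>k<N. stage_cost b u k + stage_cost b u' k)"
  proof (rule sum_strict_mono_ex1)
    show "\<forall>k\<in>{..<N}. 2 * stage_cost b (bmid N u u') k \<le> stage_cost b u k + stage_cost b u' k"
      by (simp add: stage_cost_bmid_le)
    show "\<exists>k\<in>{..<N}. 2 * stage_cost b (bmid N u u') k < stage_cost b u k + stage_cost b u' k"
      using k stage_cost_bmid_less by blast
  qed simp
  then show ?thesis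
    by (simp only: tracking_cost_eq sum_distrib_left sum.distrib)
qed

end

text \<open>Inputs and outputs are confined to boxes and the outputs are affine in the input, so the
  midpoint stays admissible.\<close>

lemma bmid_set_U:
  assumes "u \<in> set_U N b" "u' \<in> set_U N b"
  shows "bmid N u u' \<in> set_U N b"
proof -
  have s: "u \<in> block_space N (dim_u b)" "u' \<in> block_space N (dim_u b)"
    using assms by (auto simp: set_U_def)
  have "vmid (u k) (u' k) \<in> carrier_vec (dim_u b)" if "k < N" for k
    using s that by (blast intro: vmid_carrier block_space_carrier)
  then have "bmid N u u' \<in> block_space N (dim_u b)"
    unfolding block_space_def bmid_def by (auto intro!: restrict_PiE)
  moreover have "lower_y b \<le> y_out b (bmid N u u') k \<and> y_out b (bmid N u u') k \<le> upper_y b \<and>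
     lower_u b \<le> bmid N u u' k \<and> bmid N u u' k \<le> upper_u b" if k: "k < N" for k
    unfolding y_out_bmid[OF s k] bmid_apply[OF k]
    using assms k unfolding set_U_def by (blast intro: vmid_le vmid_ge)
  ultimately show ?thesis
    unfolding set_U_def by blast
qed

end

section \<open>Midpoint convexity of the objective and uniqueness of the solution of (P)\<close>

text \<open>The price term is linear and \<open>cost_f\<close> differs from
  \<open>tracking_cost\<close> by a constant, so both cancel from the comparison and the tracking
  cost decides.\<close>

lemma f_tilde_bmid:
  assumes ok: "building_ok (horizon p) (bldg p i)"
    and u: "u \<in> set_U (horizon p) (bldg p i)" and u': "u' \<in> set_U (horizon p) (bldg p i)"
  shows f_tilde_bmid_le: "2 * f_tilde p i (bmid (horizon p) u u') \<le> f_tilde p i u + f_tilde p i u'"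
    and f_tilde_bmid_less:
      "u \<noteq> u' \<Longrightarrow> 2 * f_tilde p i (bmid (horizon p) u u') < f_tilde p i u + f_tilde p i u'"
proof -
  let ?L = "\<lambda>u. \<Sum>k<horizon p. price p k * F_app (bldg p i) u k"
  have s: "u \<in> block_space (horizon p) (dim_u (bldg p i))"
      "u' \<in> block_space (horizon p) (dim_u (bldg p i))"
    using u u' by (auto simp: set_U_def)
  have "2 * ?L (bmid (horizon p) u u') = ?L u + ?L u'"
    by (simp add: F_app_bmid[OF ok s] distrib_left sum.distrib flip: sum_divide_distrib)
  then show "2 * f_tilde p i (bmid (horizon p) u u') \<le> f_tilde p i u + f_tilde p i u'"
    "u \<noteq> u' \<Longrightarrow> 2 * f_tilde p i (bmid (horizon p) u u') < f_tilde p i u + f_tilde p i u'"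
    using tracking_cost_bmid_le[OF ok s] tracking_cost_bmid_less[OF ok s]
    by (auto simp: f_tilde_def cost_f_def)
qed

lemma objective_P_eq: "objective_P p (u, v) = (\<Sum>i = 1..num_buildings p. f_tilde p i (u i))"
  by (simp add: objective_P_def f_tilde_def)

lemma solution_P_unique:
  assumes ok: "problem_ok p" and s: "solution_P p (u, v)" and s': "solution_P p (u', v')"
  shows "u = u'"
proof (rule ccontr)
  assume "u \<noteq> u'"
  let ?I = "{1..num_buildings p}" and ?N = "horizon p"
  have f: "feasible_P p (u, v)" and f': "feasible_P p (u', v')"
    using s s' by (auto simp: solution_P_def is_arg_min_def)
  have min: "objective_P p (u, v) \<le> objective_P p x" "objective_P p (u', v') \<le> objective_P p x"
    if "feasible_P p x" for x
    using s s' that unfolding solution_P_def is_arg_min_def not_less[symmetric] by blast+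
  have okb: "building_ok ?N (bldg p i)" if "i \<in> ?I" for i
    using ok that by (simp add: problem_ok_def)
  have U: "u \<in> (\<Pi>\<^sub>E i\<in>?I. set_U ?N (bldg p i))" and U': "u' \<in> (\<Pi>\<^sub>E i\<in>?I. set_U ?N (bldg p i))"
    using f f' by (auto simp: feasible_P_def)
  obtain j where j: "j \<in> ?I" "u j \<noteq> u' j"
    using \<open>u \<noteq> u'\<close> PiE_ext[OF U U'] by auto
  have m: "u i \<in> set_U ?N (bldg p i)" "u' i \<in> set_U ?N (bldg p i)" if "i \<in> ?I" for i
    using U U' that by auto
  then have bs: "u i \<in> block_space ?N (dim_u (bldg p i))" "u' i \<in> block_space ?N (dim_u (bldg p i))"
    if "i \<in> ?I" for i
    using that by (auto simp: set_U_def)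
  define w where "w = (\<lambda>i\<in>?I. bmid ?N (u i) (u' i))"
  \<comment> \<open>The coupling equation is affine in \<open>u\<close> and \<open>v\<close>
    jointly, so averaging \<open>v\<close> as well keeps it valid.\<close>
  define vw where "vw = (\<lambda>k\<in>{..<?N}. (v k + v' k) / 2)"
  have "feasible_P p (w, vw)"
    unfolding feasible_P_def prod.case
  proof (intro conjI allI impI)
    show "w \<in> (\<Pi>\<^sub>E i\<in>?I. set_U ?N (bldg p i))"
      using m okb by (auto simp: w_def intro: bmid_set_U)
    show "vw \<in> (\<Pi>\<^sub>E k\<in>{..<?N}. UNIV)"
      by (auto simp: vw_def)
    fix k assume k: "k < ?N"
    have vk: "v_lower p \<le> v k" "v k \<le> v_upper p" and v'k: "v_lower p \<le> v' k" "v' k \<le> v_upper p"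
      using f f' k by (auto simp: feasible_P_def)
    have "2 * (\<Sum>i\<in>?I. gain_G (bldg p i) * F_app (bldg p i) (w i) k)
      = (\<Sum>i\<in>?I. gain_G (bldg p i) * F_app (bldg p i) (u i) k)
      + (\<Sum>i\<in>?I. gain_G (bldg p i) * F_app (bldg p i) (u' i) k)"
      by (simp add: w_def F_app_bmid[OF okb bs k] distrib_left sum.distrib flip: sum_divide_distrib)
    then show "vw k = (\<Sum>i\<in>?I. gain_G (bldg p i) * F_app (bldg p i) (w i) k) + v_tilde p k"
      using f f' k by (simp add: feasible_P_def vw_def)
    show "v_lower p \<le> vw k" "vw k \<le> v_upper p"
      using vk v'k k by (auto simp: vw_def)
  qed
  \<comment> \<open>Each of the two minimizers is compared with the midpoint and the inequalities
    are added; strict convexity in building \<open>j\<close> contradicts the sum.\<close>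
  then have "objective_P p (u, v) + objective_P p (u', v') \<le> 2 * objective_P p (w, vw)"
    using min by fastforce
  moreover have "(\<Sum>i\<in>?I. 2 * f_tilde p i (w i)) < (\<Sum>i\<in>?I. f_tilde p i (u i) + f_tilde p i (u' i))"
  proof (rule sum_strict_mono_ex1)
    show "\<forall>i\<in>?I. 2 * f_tilde p i (w i) \<le> f_tilde p i (u i) + f_tilde p i (u' i)"
      using f_tilde_bmid_le[OF okb m] by (simp add: w_def)
    show "\<exists>i\<in>?I. 2 * f_tilde p i (w i) < f_tilde p i (u i) + f_tilde p i (u' i)"
      using f_tilde_bmid_less[OF okb m] j by (intro bexI[of _ j]) (simp_all add: w_def)
  qed simp
  then have "2 * objective_P p (w, vw) < objective_P p (u, v) + objective_P p (u', v')"
    by (simp only: objective_P_eq sum_distrib_left sum.distrib)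
  ultimately show False by simp
qed

section \<open>Slack variables and the transfer of feasibility between (P) and (D)\<close>

text \<open>Component \<open>c\<close> of the vector bounded by \<open>s k\<close> in
  \<open>set_Z\<close>: 0 stands for the upper bound on \<open>v\<close>, 1 for the lower one.
  Indexing by \<open>c\<close> lets one slack argument serve both.\<close>

definition coupling_term :: "problem \<Rightarrow> (nat \<Rightarrow> blocks) \<Rightarrow> nat \<Rightarrow> nat \<Rightarrow> nat \<Rightarrow> real" where
  "coupling_term p u c k i =
    (if c = 0
     then (v_tilde p k - v_upper p) / real (num_buildings p)
          + gain_G (bldg p i) * F_app (bldg p i) (u i) k
     else (v_lower p - v_tilde p k) / real (num_buildings p)
          - gain_G (bldg p i) * F_app (bldg p i) (u i) k)"

text \<open>There is at least one building, so the equal shares of the constants add up to the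
  whole. Under the coupling equation the sums are \<open>v k - v_upper p\<close> and
  \<open>v_lower p - v k\<close>, whose signs express the bounds on \<open>v k\<close>.\<close>

lemma sum_coupling_term:
  assumes "problem_ok p"
  shows "(\<Sum>i = 1..num_buildings p. coupling_term p u 0 k i)
      = (\<Sum>i = 1..num_buildings p. gain_G (bldg p i) * F_app (bldg p i) (u i) k)
        + v_tilde p k - v_upper p"
    and "(\<Sum>i = 1..num_buildings p. coupling_term p u (Suc 0) k i)
      = v_lower p - v_tilde p k
        - (\<Sum>i = 1..num_buildings p. gain_G (bldg p i) * F_app (bldg p i) (u i) k)"
  using assms by (auto simp: coupling_term_def sum.distrib sum_subtractf problem_ok_def)

text \<open>\<open>block_space\<close> supplies the dimension condition contained in the vector
  order; what remains are two scalar inequalities per step, ready to be summed over the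
  buildings.\<close>

lemma set_Z_iff:
  "(u i, s) \<in> set_Z p i \<longleftrightarrow> u i \<in> set_U (horizon p) (bldg p i) \<and> s \<in> block_space (horizon p) 2 \<and>
    (\<forall>k<horizon p. \<forall>c<2. coupling_term p u c k i \<le> s k $ c)"
proof -
  have "vec_of_list [a, b] - x \<le> 0\<^sub>v 2 \<longleftrightarrow> a \<le> x $ 0 \<and> b \<le> x $ 1"
    if "x \<in> carrier_vec 2" for a b :: real and x
    using that by (auto simp: less_eq_vec_def less_2_cases_iff vec_of_list_index)
  moreover have "(\<forall>c<2. coupling_term p u c k i \<le> s k $ c) \<longleftrightarrow>
    coupling_term p u 0 k i \<le> s k $ 0 \<and> coupling_term p u 1 k i \<le> s k $ 1" for k
    by (auto simp: less_2_cases_iff)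
  ultimately show ?thesis
    by (auto simp: set_Z_def coupling_term_def block_space_carrier)
qed

lemma finsum_vec_eq_0_iff:
  assumes "finite I" "\<And>i. i \<in> I \<Longrightarrow> f i \<in> carrier_vec n"
  shows "finsum_vec TYPE(real) n f I = 0\<^sub>v n \<longleftrightarrow> (\<forall>c<n. (\<Sum>i\<in>I. f i $ c) = 0)"
proof -
  have "finsum_vec TYPE(real) n f I \<in> carrier_vec n"
    using assms by (intro finsum_vec_closed) auto
  then show ?thesis
    using assms by (auto simp: vec_eq_iff index_finsum_vec)
qed

lemma feasible_P_of_D:
  assumes ok: "problem_ok p" and z: "feasible_D p z"
  shows "\<exists>v. feasible_P p (u_part p z, v)"
proof -
  let ?I = "{1..num_buildings p}" and ?N = "horizon p" and ?u = "u_part p z"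
  have Z: "(?u i, snd (z i)) \<in> set_Z p i" if "i \<in> ?I" for i
    using z that by (auto simp: feasible_D_def u_part_def)
  then have c: "coupling_term p ?u c k i \<le> snd (z i) k $ c" if "i \<in> ?I" "k < ?N" "c < 2" for i k c
    using that unfolding set_Z_iff by blast
  have s: "snd (z i) k \<in> carrier_vec 2" if "i \<in> ?I" "k < ?N" for i k
    using Z that unfolding set_Z_iff by (blast intro: block_space_carrier)
  have nonpos: "(\<Sum>i\<in>?I. coupling_term p ?u c k i) \<le> 0" if "k < ?N" "c < 2" for c k
  proof -
    have "(\<Sum>i\<in>?I. snd (z i) k $ c) = 0"
      using z that finsum_vec_eq_0_iff[of ?I "\<lambda>i. snd (z i) k" 2, OF _ s]
      unfolding feasible_D_def by blast
    then show ?thesis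
      using sum_mono[of ?I "coupling_term p ?u c k" "\<lambda>i. snd (z i) k $ c"] c that by simp
  qed
  \<comment> \<open>The coupling equation forces this choice; the restriction makes \<open>v\<close>
    extensional.\<close>
  define v where "v = (\<lambda>k\<in>{..<?N}.
    (\<Sum>i\<in>?I. gain_G (bldg p i) * F_app (bldg p i) (?u i) k) + v_tilde p k)"
  have "v_lower p \<le> v k \<and> v k \<le> v_upper p" if "k < ?N" for k
    using nonpos[OF that, of 0] nonpos[OF that, of "Suc 0"] that
    unfolding sum_coupling_term[OF ok] by (simp add: v_def)
  moreover have "?u \<in> (\<Pi>\<^sub>E i\<in>?I. set_U ?N (bldg p i))"
    using Z unfolding set_Z_iff by (auto simp: u_part_def)
  ultimately have "feasible_P p (?u, v)"
    by (auto simp: feasible_P_def v_def)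
  then show ?thesis by blast
qed

lemma feasible_D_of_P:
  assumes ok: "problem_ok p" and f: "feasible_P p (u, v)"
  shows "\<exists>z. feasible_D p z \<and> u_part p z = u"
proof -
  let ?M = "num_buildings p"
  let ?I = "{1..?M}" and ?N = "horizon p"
  let ?T = "\<lambda>c k. \<Sum>i\<in>?I. coupling_term p u c k i"
  have M: "?M \<ge> 1" using ok by (simp add: problem_ok_def)
  have U: "u \<in> (\<Pi>\<^sub>E i\<in>?I. set_U ?N (bldg p i))"
    using f by (auto simp: feasible_P_def)
  have nonpos: "?T c k \<le> 0" if "k < ?N" "c < 2" for c k
  proof -
    have vk: "v k = (\<Sum>i\<in>?I. gain_G (bldg p i) * F_app (bldg p i) (u i) k) + v_tilde p k"
        "v_lower p \<le> v k" "v k \<le> v_upper p"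
      using f \<open>k < ?N\<close> by (auto simp: feasible_P_def)
    have "?T 0 k \<le> 0" "?T (Suc 0) k \<le> 0"
      unfolding sum_coupling_term[OF ok] using vk by linarith+
    then show ?thesis
      using that by (metis less_2_cases)
  qed
  \<comment> \<open>The mean of the coupling terms is subtracted. As their total is nonpositive,
    each slack dominates its term, and the equal shares of the total make the slacks sum to
    zero.\<close>
  define s where "s i = (\<lambda>k\<in>{..<?N}. vec 2 (\<lambda>c. coupling_term p u c k i - ?T c k / ?M))" for i
  define z where "z = (\<lambda>i\<in>?I. (u i, s i))"
  have "coupling_term p u c k i \<le> s i k $ c" if "k < ?N" "c < 2" for i k c
    using nonpos[OF that] that M by (simp add: s_def divide_nonpos_pos)
  then have "z \<in> (\<Pi>\<^sub>E i\<in>?I. set_Z p i)"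
    using U by (auto simp: z_def set_Z_iff) (auto simp: s_def block_space_def)
  moreover have "finsum_vec TYPE(real) 2 (\<lambda>i. snd (z i) k) ?I = 0\<^sub>v 2" if "k < ?N" for k
  proof -
    have "(\<Sum>i\<in>?I. snd (z i) k $ c) = 0" if "c < 2" for c
      using that \<open>k < ?N\<close> M by (simp add: z_def s_def sum_subtractf)
    then show ?thesis
      using that by (subst finsum_vec_eq_0_iff) (auto simp: z_def s_def)
  qed
  ultimately have "feasible_D p z"
    by (simp add: feasible_D_def)
  \<comment> \<open>Outside the building range both sides are \<open>undefined\<close>, because
    \<open>u\<close> is extensional.\<close>
  moreover have "u_part p z = u"
    using U by (auto simp: u_part_def z_def fun_eq_iff PiE_def extensional_def)
  ultimately show ?thesis by blast
qed

section \<open>Transfer of minimality between the two problems\<close>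

text \<open>\<open>v\<close> is arbitrary, so values are compared through the inputs alone,
  whichever \<open>v\<close> the transfer of feasibility supplies.\<close>

lemma objective_D_eq: "objective_D p z = objective_P p (u_part p z, v)"
  by (simp add: objective_D_def objective_P_eq u_part_def)

theorem proposition1:
  fixes p :: problem
  assumes "problem_ok p"
  shows "(\<forall>u v. (\<exists>uv. feasible_P p uv) \<and> solution_P p (u, v) \<longrightarrow>
            (\<exists>z. solution_D p z \<and> u_part p z = u)) \<and>
         (\<forall>z. (\<exists>z'. feasible_D p z') \<and> solution_D p z \<longrightarrow>
            (\<exists>v. solution_P p (u_part p z, v)) \<and>
            (\<forall>u' v'. solution_P p (u', v') \<longrightarrow> u' = u_part p z))"
proof (intro conjI allI impI)
  fix u v assume "(\<exists>uv. feasible_P p uv) \<and> solution_P p (u, v)"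
  then have s: "feasible_P p (u, v)" "\<And>x. feasible_P p x \<Longrightarrow> objective_P p (u, v) \<le> objective_P p x"
    unfolding solution_P_def is_arg_min_def not_less[symmetric] by blast+
  obtain z where z: "feasible_D p z" "u_part p z = u"
    using feasible_D_of_P[OF assms s(1)] by blast
  \<comment> \<open>A competitor in (D) yields a feasible point of (P) with the same value, so the
    optimality of \<open>u\<close> carries over.\<close>
  have "objective_D p z \<le> objective_D p z'" if "feasible_D p z'" for z'
    using feasible_P_of_D[OF assms that] s(2) z(2) by (metis objective_D_eq)
  with z show "\<exists>z. solution_D p z \<and> u_part p z = u"
    by (auto simp: solution_D_def is_arg_min_def not_less)
next
  fix z assume "(\<exists>z'. feasible_D p z') \<and> solution_D p z"
  then have s: "feasible_D p z" "\<And>x. feasible_D p x \<Longrightarrow> objective_D p z \<le> objective_D p x"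
    by (auto simp: solution_D_def is_arg_min_def not_less)
  obtain v where v: "feasible_P p (u_part p z, v)"
    using feasible_P_of_D[OF assms s(1)] by blast
  \<comment> \<open>Conversely, a competitor in (P) lifts to a feasible point of (D) with the same
    inputs and value.\<close>
  have "objective_P p (u_part p z, v) \<le> objective_P p (u', v')" if "feasible_P p (u', v')" for u' v'
    using feasible_D_of_P[OF assms that] s(2) by (metis objective_D_eq)
  with v have sol: "solution_P p (u_part p z, v)"
    by (auto simp: solution_P_def is_arg_min_def not_less)
  then show "\<exists>v. solution_P p (u_part p z, v)" by blast
  \<comment> \<open>Strict convexity enters only here, to make the minimizer of (P) unique in its
    inputs.\<close>
  show "u' = u_part p z" if "solution_P p (u', v')" for u' v'
    using solution_P_unique[OF assms that sol] .
qed

end
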